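(* Let the thickness $h>0$ be so small that $h|\kappa_1|<\frac12$ and $h|\kappa_2|<\frac12$ on $\omega$, where $\kappa_1,\kappa_2$ are the principal curvatures of the surface $y_0(\omega)$, and let the constitutive coefficients satisfy $\mu>0$, $\mu_{\rm c}>0$, $2\lambda+\mu>0$, $b_1>0$, $b_2>0$, $b_3>0$. Then the energy density $$W(\mathcal{E}_{m,s},\mathcal{K}_{e,s})=W_{\mathrm{memb}}(\mathcal{E}_{m,s})+W_{\mathrm{memb,bend}}(\mathcal{E}_{m,s},\mathcal{K}_{e,s})+W_{\mathrm{bend,curv}}(\mathcal{K}_{e,s})$$ (including terms up to order $O(h^5)$) is coercive in the sense that there exists a constant $a_1^+>0$, depending on the constitutive coefficients, such that $$W(\mathcal{E}_{m,s},\mathcal{K}_{e,s})\ \ge\ a_1^+\big(\lVert \mathcal{E}_{m,s}\rVert^2+\lVert\mathcal{K}_{e,s}\rVert^2\big)$$ for the strain and curvature tensors $\mathcal{E}_{m,s},\mathcal{K}_{e,s}$ of any midsurface deformation $m$ and microrotation $\overline{Q}_{e,s}$.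
   Context: Notation: $\langle X,Y\rangle=\mathrm{tr}(XY^T)$ and $\lVert X\rVert^2=\langle X,X\rangle$ (Frobenius); $\mathrm{sym}\,X=\frac12(X+X^T)$, $\mathrm{skew}\,X=\frac12(X-X^T)$, $\mathrm{dev}\,X=X-\frac13\mathrm{tr}(X)\,\mathbb{1}_3$ for $X\in\mathbb{R}^{3\times3}$, with $\mathbb 1_3$ the identity. $(A_1|A_2|A_3)$ is the matrix with columns $A_1,A_2,A_3$; for a $3\times 2$ matrix $M$ and a vector $v$, $(M|v)$ is the $3\times3$ matrix obtained by appending the column $v$. For skew-symmetric $A\in\mathfrak{so}(3)$, $\mathrm{axl}\,A=(-A_{23},A_{13},-A_{12})^T$. Geometry: $\omega\subset\mathbb{R}^2$ is a bounded domain with Lipschitz boundary, $h>0$ is the constant thickness, $y_0:\omega\to\mathbb{R}^3$ is a $C^2$ map parametrizing the midsurface of the curved reference configuration, $n_0=\frac{\partial_{x_1}y_0\times\partial_{x_2}y_0}{\lVert\partial_{x_1}y_0\times\partial_{x_2}y_0\rVert}$, and $\Theta(x_1,x_2,x_3)=y_0(x_1,x_2)+x_3\,n_0(x_1,x_2)$ is assumed to be a $C^1$-diffeomorphism from $\Omega_h=\omega\times(-\frac h2,\frac h2)$ onto its image. Then $\nabla_x\Theta(0)=(\nabla y_0|n_0)$ (value at $x_3=0$). Put $\mathrm{I}_{y_0}=(\nabla y_0)^T\nabla y_0$, $\mathrm{II}_{y_0}=-(\nabla y_0)^T\nabla n_0$, $\mathrm{L}_{y_0}=\mathrm{I}_{y_0}^{-1}\mathrm{II}_{y_0}$,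 $\mathrm{K}=\det\mathrm{L}_{y_0}$ (Gauss curvature), $\mathrm{H}=\frac12\mathrm{tr}\,\mathrm{L}_{y_0}$ (mean curvature); $\kappa_1,\kappa_2$ are the eigenvalues of $\mathrm{L}_{y_0}$. Define $$\mathrm{B}_{y_0}=-(\nabla n_0|0)[\nabla_x\Theta(0)]^{-1},\qquad \mathrm{C}_{y_0}=\det(\nabla_x\Theta(0))\,[\nabla_x\Theta(0)]^{-T}\begin{pmatrix}0&1&0\\-1&0&0\\0&0&0\end{pmatrix}[\nabla_x\Theta(0)]^{-1}.$$ Strain measures: for $m:\omega\to\mathbb{R}^3$ and $\overline{Q}_{e,s}:\omega\to\mathrm{SO}(3)$, $$\mathcal{E}_{m,s}=\overline{Q}_{e,s}^T(\nabla m\,|\,\overline{Q}_{e,s}\nabla_x\Theta(0)e_3)[\nabla_x\Theta(0)]^{-1}-\mathbb{1}_3,$$ $$\mathcal{K}_{e,s}=(\mathrm{axl}(\overline{Q}_{e,s}^T\partial_{x_1}\overline{Q}_{e,s})\,|\,\mathrm{axl}(\overline{Q}_{e,s}^T\partial_{x_2}\overline{Q}_{e,s})\,|\,0)[\nabla_x\Theta(0)]^{-1}.$$ Energy (pointwise on $\omega$): with $\mathcal E=\mathcal{E}_{m,s}$, $\mathcal K=\mathcal{K}_{e,s}$, $$W_{\mathrm{memb}}(\mathcal E)=\Big(h+\mathrm K\tfrac{h^3}{12}\Big)W_{\mathrm{shell}}(\mathcal E),$$ $$\begin{aligned}W_{\mathrm{memb,bend}}(\mathcal E,\mathcal K)=&\Big(\tfrac{h^3}{12}-\mathrm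 K\tfrac{h^5}{80}\Big)W_{\mathrm{shell}}(\mathcal E\mathrm B_{y_0}+\mathrm C_{y_0}\mathcal K)-\tfrac{h^3}{3}\mathrm H\,\mathcal W_{\mathrm{shell}}(\mathcal E,\mathcal E\mathrm B_{y_0}+\mathrm C_{y_0}\mathcal K)\\&+\tfrac{h^3}{6}\mathcal W_{\mathrm{shell}}(\mathcal E,(\mathcal E\mathrm B_{y_0}+\mathrm C_{y_0}\mathcal K)\mathrm B_{y_0})+\tfrac{h^5}{80}W_{\mathrm{mp}}((\mathcal E\mathrm B_{y_0}+\mathrm C_{y_0}\mathcal K)\mathrm B_{y_0}),\end{aligned}$$ $$W_{\mathrm{bend,curv}}(\mathcal K)=\Big(h-\mathrm K\tfrac{h^3}{12}\Big)W_{\mathrm{curv}}(\mathcal K)+\Big(\tfrac{h^3}{12}-\mathrm K\tfrac{h^5}{80}\Big)W_{\mathrm{curv}}(\mathcal K\mathrm B_{y_0})+\tfrac{h^5}{80}W_{\mathrm{curv}}(\mathcal K\mathrm B_{y_0}^2),$$ where $$W_{\mathrm{shell}}(S)=\mu\lVert\mathrm{sym}\,S\rVert^2+\mu_{\rm c}\lVert\mathrm{skew}\,S\rVert^2+\tfrac{\lambda\mu}{\lambda+2\mu}[\mathrm{tr}\,S]^2,$$ $$\mathcal W_{\mathrm{shell}}(S,T)=\mu\langle\mathrm{sym}\,S,\mathrm{sym}\,T\rangle+\mu_{\rm c}\langle\mathrm{skew}\,S,\mathrm{skew}\,T\rangle+\tfrac{\lambda\mu}{\lambda+2\mu}\mathrm{tr}(S)\,\mathrm{tr}(T),$$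 $$W_{\mathrm{mp}}(S)=\mu\lVert\mathrm{sym}\,S\rVert^2+\mu_{\rm c}\lVert\mathrm{skew}\,S\rVert^2+\tfrac{\lambda}{2}[\mathrm{tr}\,S]^2,$$ $$W_{\mathrm{curv}}(S)=\mu L_{\rm c}^2\big(b_1\lVert\mathrm{dev}\,\mathrm{sym}\,S\rVert^2+b_2\lVert\mathrm{skew}\,S\rVert^2+b_3[\mathrm{tr}\,S]^2\big).$$ Here $\mu,\lambda,\mu_{\rm c},b_1,b_2,b_3$ are real constitutive coefficients and $L_{\rm c}>0$ is a fixed internal length. *)

theory Defs
  imports "HOL-Analysis.Analysis"
begin

text \<open>
  Matrices with \<open>r\<close> rows and \<open>c\<close> columns have type \<open>real ^ 'c ^ 'r\<close>. The library norm and inner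
  product on this type are the Frobenius ones:
\<close>

lemma frobenius_inner: "X \<bullet> Y = trace (X ** transpose Y)"
  for X Y :: "real ^ 'c ^ 'r"
  by (simp add: trace_def matrix_matrix_mult_def transpose_def inner_vec_def)

lemma frobenius_norm: "(norm X)\<^sup>2 = trace (X ** transpose X)"
  for X :: "real ^ 'c ^ 'r"
  by (simp add: power2_norm_eq_inner frobenius_inner)

definition symm :: "real ^ 3 ^ 3 \<Rightarrow> real ^ 3 ^ 3" where
  "symm X = (1/2) *\<^sub>R (X + transpose X)"

definition skew :: "real ^ 3 ^ 3 \<Rightarrow> real ^ 3 ^ 3" where
  "skew X = (1/2) *\<^sub>R (X - transpose X)"

definition dev :: "real ^ 3 ^ 3 \<Rightarrow> real ^ 3 ^ 3" where
  "dev X = X - (trace X / 3) *\<^sub>R mat 1"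

definition axl :: "real ^ 3 ^ 3 \<Rightarrow> real ^ 3" where
  "axl A = vector [- A $ 2 $ 3, A $ 1 $ 3, - A $ 1 $ 2]"

text \<open>\<open>(A\<^sub>1 | A\<^sub>2 | A\<^sub>3)\<close> and \<open>(M | v)\<close>:\<close>

definition cols :: "real ^ 3 \<Rightarrow> real ^ 3 \<Rightarrow> real ^ 3 \<Rightarrow> real ^ 3 ^ 3" where
  "cols a b c = transpose (vector [a, b, c])"

definition append_col :: "real ^ 2 ^ 3 \<Rightarrow> real ^ 3 \<Rightarrow> real ^ 3 ^ 3" where
  "append_col M v = cols (column 1 M) (column 2 M) v"


section \<open>Domains and smoothness\<close>

definition partial :: "'n \<Rightarrow> (real ^ 'n \<Rightarrow> 'b::real_normed_vector) \<Rightarrow> real ^ 'n \<Rightarrow> 'b" where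
  "partial i f x = frechet_derivative f (at x) (axis i 1)"

text \<open>
  The classes \<open>C\<^sup>1\<close> and \<open>C\<^sup>2\<close> on an open set. In finite dimension, continuity of all directional
  derivatives is continuity of the derivative in operator norm.
\<close>

definition C1_on :: "('a::euclidean_space \<Rightarrow> 'b::real_normed_vector) \<Rightarrow> 'a set \<Rightarrow> bool" where
  "C1_on f S \<longleftrightarrow> (\<forall>x\<in>S. f differentiable (at x)) \<and>
     (\<forall>v. continuous_on S (\<lambda>x. frechet_derivative f (at x) v))"

definition C2_on :: "('a::euclidean_space \<Rightarrow> 'b::real_normed_vector) \<Rightarrow> 'a set \<Rightarrow> bool" where
  "C2_on f S \<longleftrightarrow> C1_on f S \<and> (\<forall>v. C1_on (\<lambda>x. frechet_derivative f (at x) v) S)"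

definition C1_diffeo_onto_image :: "('a::euclidean_space \<Rightarrow> 'a) \<Rightarrow> 'a set \<Rightarrow> bool" where
  "C1_diffeo_onto_image f S \<longleftrightarrow>
     open S \<and> inj_on f S \<and> open (f ` S) \<and> C1_on f S \<and> C1_on (inv_into S f) (f ` S)"

text \<open>
  Near each boundary point, and after a rigid change of coordinates, the set is the part of the
  plane strictly above the graph of a Lipschitz function. Orthogonal maps fix the origin, which is
  no restriction because \<open>\<gamma>\<close> is an arbitrary Lipschitz function on the line.
\<close>

definition lipschitz_boundary :: "(real ^ 2) set \<Rightarrow> bool" where
  "lipschitz_boundary S \<longleftrightarrow>
     (\<forall>p \<in> frontier S. \<exists>r>0. \<exists>(T :: real ^ 2 \<Rightarrow> real ^ 2) (\<gamma> :: real \<Rightarrow> real) L.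
        orthogonal_transformation T \<and> L-lipschitz_on UNIV \<gamma> \<and>
        (\<forall>x \<in> ball p r. x \<in> S \<longleftrightarrow> \<gamma> (T x $ 1) < T x $ 2))"

definition bounded_lipschitz_domain :: "(real ^ 2) set \<Rightarrow> bool" where
  "bounded_lipschitz_domain \<omega> \<longleftrightarrow>
     \<omega> \<noteq> {} \<and> open \<omega> \<and> connected \<omega> \<and> bounded \<omega> \<and> lipschitz_boundary \<omega>"


section \<open>Geometry of the reference midsurface\<close>

definition unit_normal :: "(real ^ 2 \<Rightarrow> real ^ 3) \<Rightarrow> real ^ 2 \<Rightarrow> real ^ 3" where
  "unit_normal y0 x =
     (let c = cross3 (partial 1 y0 x) (partial 2 y0 x) in (1 / norm c) *\<^sub>R c)"

definition shell_map :: "(real ^ 2 \<Rightarrow> real ^ 3) \<Rightarrow> real ^ 3 \<Rightarrow> real ^ 3" where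
  "shell_map y0 X = (let x = vector [X $ 1, X $ 2] in y0 x + X $ 3 *\<^sub>R unit_normal y0 x)"

definition shell_domain :: "(real ^ 2) set \<Rightarrow> real \<Rightarrow> (real ^ 3) set" where
  "shell_domain \<omega> h = {X. vector [X $ 1, X $ 2] \<in> \<omega> \<and> - h / 2 < X $ 3 \<and> X $ 3 < h / 2}"

definition reference_shell :: "(real ^ 2) set \<Rightarrow> real \<Rightarrow> (real ^ 2 \<Rightarrow> real ^ 3) \<Rightarrow> bool" where
  "reference_shell \<omega> h y0 \<longleftrightarrow>
     bounded_lipschitz_domain \<omega> \<and> C2_on y0 \<omega> \<and>
     C1_diffeo_onto_image (shell_map y0) (shell_domain \<omega> h)"

text \<open>\<open>\<nabla>\<^sub>x\<Theta>(0)\<close>, the Jacobian of the shell map on the midsurface \<open>x\<^sub>3 = 0\<close>:\<close>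

definition grad_Theta0 :: "(real ^ 2 \<Rightarrow> real ^ 3) \<Rightarrow> real ^ 2 \<Rightarrow> real ^ 3 ^ 3" where
  "grad_Theta0 y0 x = jacobian (shell_map y0) (at (vector [x $ 1, x $ 2, 0]))"

definition first_form :: "(real ^ 2 \<Rightarrow> real ^ 3) \<Rightarrow> real ^ 2 \<Rightarrow> real ^ 2 ^ 2" where
  "first_form y0 x = transpose (jacobian y0 (at x)) ** jacobian y0 (at x)"

definition second_form :: "(real ^ 2 \<Rightarrow> real ^ 3) \<Rightarrow> real ^ 2 \<Rightarrow> real ^ 2 ^ 2" where
  "second_form y0 x = - (transpose (jacobian y0 (at x)) ** jacobian (unit_normal y0) (at x))"

definition weingarten :: "(real ^ 2 \<Rightarrow> real ^ 3) \<Rightarrow> real ^ 2 \<Rightarrow> real ^ 2 ^ 2" where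
  "weingarten y0 x = matrix_inv (first_form y0 x) ** second_form y0 x"

definition gauss_curvature :: "(real ^ 2 \<Rightarrow> real ^ 3) \<Rightarrow> real ^ 2 \<Rightarrow> real" where
  "gauss_curvature y0 x = det (weingarten y0 x)"

definition mean_curvature :: "(real ^ 2 \<Rightarrow> real ^ 3) \<Rightarrow> real ^ 2 \<Rightarrow> real" where
  "mean_curvature y0 x = trace (weingarten y0 x) / 2"

definition principal_curvature :: "(real ^ 2 \<Rightarrow> real ^ 3) \<Rightarrow> real ^ 2 \<Rightarrow> real \<Rightarrow> bool" where
  "principal_curvature y0 x \<kappa> \<longleftrightarrow> (\<exists>v. v \<noteq> 0 \<and> weingarten y0 x *v v = \<kappa> *\<^sub>R v)"

definition B_tensor :: "(real ^ 2 \<Rightarrow> real ^ 3) \<Rightarrow> real ^ 2 \<Rightarrow> real ^ 3 ^ 3" where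
  "B_tensor y0 x =
     - (append_col (jacobian (unit_normal y0) (at x)) 0 ** matrix_inv (grad_Theta0 y0 x))"

definition C_tensor :: "(real ^ 2 \<Rightarrow> real ^ 3) \<Rightarrow> real ^ 2 \<Rightarrow> real ^ 3 ^ 3" where
  "C_tensor y0 x =
     det (grad_Theta0 y0 x) *\<^sub>R
       (transpose (matrix_inv (grad_Theta0 y0 x))
        ** vector [vector [0, 1, 0], vector [-1, 0, 0], vector [0, 0, 0]]
        ** matrix_inv (grad_Theta0 y0 x))"


section \<open>Strain measures\<close>

definition strain ::
  "(real ^ 2 \<Rightarrow> real ^ 3) \<Rightarrow> (real ^ 2 \<Rightarrow> real ^ 3) \<Rightarrow> (real ^ 2 \<Rightarrow> real ^ 3 ^ 3) \<Rightarrow> real ^ 2 \<Rightarrow> real ^ 3 ^ 3"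
  where
  "strain y0 m Q x =
     transpose (Q x)
       ** append_col (jacobian m (at x)) (Q x *v (grad_Theta0 y0 x *v axis 3 1))
       ** matrix_inv (grad_Theta0 y0 x)
     - mat 1"

definition bending_curvature ::
  "(real ^ 2 \<Rightarrow> real ^ 3) \<Rightarrow> (real ^ 2 \<Rightarrow> real ^ 3 ^ 3) \<Rightarrow> real ^ 2 \<Rightarrow> real ^ 3 ^ 3" where
  "bending_curvature y0 Q x =
     cols (axl (transpose (Q x) ** partial 1 Q x)) (axl (transpose (Q x) ** partial 2 Q x)) 0
       ** matrix_inv (grad_Theta0 y0 x)"


section \<open>Energy density\<close>

definition W_shell2 :: "real \<Rightarrow> real \<Rightarrow> real \<Rightarrow> real ^ 3 ^ 3 \<Rightarrow> real ^ 3 ^ 3 \<Rightarrow> real" where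
  "W_shell2 \<mu> lam \<mu>\<^sub>c S T =
     \<mu> * (symm S \<bullet> symm T) + \<mu>\<^sub>c * (skew S \<bullet> skew T)
     + lam * \<mu> / (lam + 2 * \<mu>) * (trace S * trace T)"

definition W_shell :: "real \<Rightarrow> real \<Rightarrow> real \<Rightarrow> real ^ 3 ^ 3 \<Rightarrow> real" where
  "W_shell \<mu> lam \<mu>\<^sub>c S =
     \<mu> * (norm (symm S))\<^sup>2 + \<mu>\<^sub>c * (norm (skew S))\<^sup>2 + lam * \<mu> / (lam + 2 * \<mu>) * (trace S)\<^sup>2"

definition W_mp :: "real \<Rightarrow> real \<Rightarrow> real \<Rightarrow> real ^ 3 ^ 3 \<Rightarrow> real" where
  "W_mp \<mu> lam \<mu>\<^sub>c S =
     \<mu> * (norm (symm S))\<^sup>2 + \<mu>\<^sub>c * (norm (skew S))\<^sup>2 + lam / 2 * (trace S)\<^sup>2"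

definition W_curv ::
  "real \<Rightarrow> real \<Rightarrow> real \<Rightarrow> real \<Rightarrow> real \<Rightarrow> real ^ 3 ^ 3 \<Rightarrow> real" where
  "W_curv \<mu> L\<^sub>c b1 b2 b3 S =
     \<mu> * L\<^sub>c\<^sup>2 * (b1 * (norm (dev (symm S)))\<^sup>2 + b2 * (norm (skew S))\<^sup>2 + b3 * (trace S)\<^sup>2)"

text \<open>
  The energy densities depend on the point \<open>x\<close> of the midsurface through the curvatures and the
  tensors \<open>B\<close> and \<open>C\<close> of \<open>y0\<close>; here \<open>E\<close> and \<open>K\<close> are arbitrary tensors.
\<close>

definition W_memb ::
  "real \<Rightarrow> real \<Rightarrow> real \<Rightarrow> real \<Rightarrow> (real ^ 2 \<Rightarrow> real ^ 3) \<Rightarrow> real ^ 2 \<Rightarrow> real ^ 3 ^ 3 \<Rightarrow> real" where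
  "W_memb h \<mu> lam \<mu>\<^sub>c y0 x E =
     (h + gauss_curvature y0 x * (h ^ 3 / 12)) * W_shell \<mu> lam \<mu>\<^sub>c E"

definition W_memb_bend ::
  "real \<Rightarrow> real \<Rightarrow> real \<Rightarrow> real \<Rightarrow> (real ^ 2 \<Rightarrow> real ^ 3) \<Rightarrow> real ^ 2
    \<Rightarrow> real ^ 3 ^ 3 \<Rightarrow> real ^ 3 ^ 3 \<Rightarrow> real" where
  "W_memb_bend h \<mu> lam \<mu>\<^sub>c y0 x E K =
     (let F = E ** B_tensor y0 x + C_tensor y0 x ** K in
       (h ^ 3 / 12 - gauss_curvature y0 x * (h ^ 5 / 80)) * W_shell \<mu> lam \<mu>\<^sub>c F
       - h ^ 3 / 3 * mean_curvature y0 x * W_shell2 \<mu> lam \<mu>\<^sub>c E F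
       + h ^ 3 / 6 * W_shell2 \<mu> lam \<mu>\<^sub>c E (F ** B_tensor y0 x)
       + h ^ 5 / 80 * W_mp \<mu> lam \<mu>\<^sub>c (F ** B_tensor y0 x))"

definition W_bend_curv ::
  "real \<Rightarrow> real \<Rightarrow> real \<Rightarrow> real \<Rightarrow> real \<Rightarrow> real \<Rightarrow> (real ^ 2 \<Rightarrow> real ^ 3) \<Rightarrow> real ^ 2
    \<Rightarrow> real ^ 3 ^ 3 \<Rightarrow> real" where
  "W_bend_curv h \<mu> L\<^sub>c b1 b2 b3 y0 x K =
     (h - gauss_curvature y0 x * (h ^ 3 / 12)) * W_curv \<mu> L\<^sub>c b1 b2 b3 K
     + (h ^ 3 / 12 - gauss_curvature y0 x * (h ^ 5 / 80))
         * W_curv \<mu> L\<^sub>c b1 b2 b3 (K ** B_tensor y0 x)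
     + h ^ 5 / 80 * W_curv \<mu> L\<^sub>c b1 b2 b3 (K ** (B_tensor y0 x ** B_tensor y0 x))"

definition W_energy ::
  "real \<Rightarrow> real \<Rightarrow> real \<Rightarrow> real \<Rightarrow> real \<Rightarrow> real \<Rightarrow> real \<Rightarrow> real
    \<Rightarrow> (real ^ 2 \<Rightarrow> real ^ 3) \<Rightarrow> real ^ 2 \<Rightarrow> real ^ 3 ^ 3 \<Rightarrow> real ^ 3 ^ 3 \<Rightarrow> real" where
  "W_energy h \<mu> lam \<mu>\<^sub>c L\<^sub>c b1 b2 b3 y0 x E K =
     W_memb h \<mu> lam \<mu>\<^sub>c y0 x E + W_memb_bend h \<mu> lam \<mu>\<^sub>c y0 x E K
     + W_bend_curv h \<mu> L\<^sub>c b1 b2 b3 y0 x K"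

end

theory Submission
  imports Defs
begin

text \<open>
  No structural identity relating \<open>E\<close>, \<open>K\<close>, \<open>B\<close> and \<open>C\<close> is needed. Write \<open>F = E B + C K\<close>. The membrane
  part is bounded below by a quadratic form in \<open>E\<close>, \<open>F\<close>, \<open>F B\<close> whose coefficients involve only
  \<open>h\<close>, \<open>H\<close> and the Gauss curvature. As \<open>h |H| \<le> 1/2\<close> and \<open>h\<^sup>2 |det L| \<le> 1/4\<close>, Young's inequality
  absorbs both mixed terms: the one in \<open>(E, F)\<close> costs \<open>h/6\<close> and the one in \<open>(E, F B)\<close> costs
  \<open>5h/9\<close> of the coefficient \<open>47h/48\<close> of \<open>W\<^sub>s\<^sub>h\<^sub>e\<^sub>l\<^sub>l(E)\<close>, which leaves more than \<open>h/4\<close>.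

  The hypothesis on the principal curvatures controls \<open>H\<close> and \<open>det L\<close> only because the Weingarten map
  has real eigenvalues; this rests on the symmetry of the second fundamental form, hence of the second
  derivatives of \<open>y0\<close>, and on the regularity of the parametrization.
\<close>

section \<open>Coercivity of the quadratic forms\<close>

lemma symm_add: "symm (S + T) = symm S + symm T"
  and symm_scaleR: "symm (a *\<^sub>R S) = a *\<^sub>R symm S"
  and skew_add: "skew (S + T) = skew S + skew T"
  and skew_scaleR: "skew (a *\<^sub>R S) = a *\<^sub>R skew S"
  by (simp_all add: symm_def skew_def transpose_def vec_eq_iff algebra_simps)

lemma trace_scaleR: "trace (a *\<^sub>R S) = a * trace S" for S :: "real ^ 3 ^ 3"
  by (simp add: trace_def sum_distrib_left)

text \<open>\<open>W_shell\<close> is a quadratic form with polar form \<open>W_shell2\<close>; the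
  weighted Young inequality is read off from this expansion.\<close>

lemma W_shell_add_scaleR:
  "W_shell \<mu> lam \<mu>\<^sub>c (a *\<^sub>R S + b *\<^sub>R T) =
    a\<^sup>2 * W_shell \<mu> lam \<mu>\<^sub>c S + 2 * a * b * W_shell2 \<mu> lam \<mu>\<^sub>c S T + b\<^sup>2 * W_shell \<mu> lam \<mu>\<^sub>c T"
proof -
  have "(norm (a *\<^sub>R X + b *\<^sub>R Y))\<^sup>2 = a\<^sup>2 * (norm X)\<^sup>2 + 2 * a * b * (X \<bullet> Y) + b\<^sup>2 * (norm Y)\<^sup>2"
    for X Y :: "real ^ 3 ^ 3"
    unfolding power2_norm_eq_inner
    by (simp add: inner_add_left inner_add_right inner_commute[of Y X] power2_eq_square algebra_simps)
  then show ?thesis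
    unfolding W_shell_def W_shell2_def symm_add symm_scaleR skew_add skew_scaleR
      trace_add trace_scaleR
    by (simp add: power2_eq_square distrib_left distrib_right mult_ac)
qed

lemma norm_symm_skew: "(norm S)\<^sup>2 = (norm (symm S))\<^sup>2 + (norm (skew S))\<^sup>2"
  unfolding power2_norm_eq_inner
  by (simp add: symm_def skew_def transpose_def inner_vec_def sum_3 field_simps)

text \<open>Pythagoras: \<open>dev\<close> is the orthogonal projection along the identity, whose
  squared Frobenius norm is 3.\<close>

lemma norm_dev: "(norm (dev X))\<^sup>2 = (norm X)\<^sup>2 - (trace X)\<^sup>2 / 3"
proof -
  have "X \<bullet> mat 1 = trace X" and "(mat 1 :: real ^ 3 ^ 3) \<bullet> mat 1 = 3"
    by (simp_all add: inner_vec_def trace_def mat_def sum_3)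
  then show ?thesis
    unfolding power2_norm_eq_inner dev_def
    by (simp add: inner_diff_left inner_diff_right inner_commute[of "mat 1" X] power2_eq_square)
qed

lemma norm_symm_dev: "(norm (symm S))\<^sup>2 = (norm (dev (symm S)))\<^sup>2 + (trace S)\<^sup>2 / 3"
proof -
  have "trace (symm S) = trace S"
    by (simp add: symm_def trace_def transpose_def sum_3)
  then show ?thesis
    by (simp add: norm_dev)
qed

text \<open>In the orthogonal splitting of \<open>S\<close> into deviatoric symmetric, skew and
  spherical parts the form is diagonal, so it suffices that its three coefficients are
  positive.\<close>

lemma W_shell_coercive:
  assumes "\<mu> > 0" "\<mu>\<^sub>c > 0" "2 * lam + \<mu> > 0"
  obtains c where "c > 0" "\<And>S. W_shell \<mu> lam \<mu>\<^sub>c S \<ge> c * (norm S)\<^sup>2"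
proof
  \<comment> \<open>The trace coefficient once the spherical share
    \<open>(trace S)\<^sup>2 / 3\<close> of the symmetric part is moved into it. Its factorization
    below is where \<open>2 * lam + \<mu> > 0\<close> enters.\<close>
  define \<beta> where "\<beta> = \<mu> / 3 + lam * \<mu> / (lam + 2 * \<mu>)"
  have pos: "lam + 2 * \<mu> > 0" using assms by linarith
  have "\<beta> = \<mu> * (2 * (2 * lam + \<mu>)) / (3 * (lam + 2 * \<mu>))"
    using pos by (simp add: \<beta>_def field_simps)
  then have "\<beta> > 0" using assms pos by simp
  \<comment> \<open>The factor 3 appears because the spherical part contributes only a third of the
    squared trace to the squared norm.\<close>
  define c where "c = min (min \<mu> \<mu>\<^sub>c) (3 * \<beta>)"
  show "c > 0" using assms \<open>\<beta> > 0\<close> by (simp add: c_def)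
  show "W_shell \<mu> lam \<mu>\<^sub>c S \<ge> c * (norm S)\<^sup>2" for S
  proof -
    have "c * (norm (dev (symm S)))\<^sup>2 \<le> \<mu> * (norm (dev (symm S)))\<^sup>2"
      "c * (norm (skew S))\<^sup>2 \<le> \<mu>\<^sub>c * (norm (skew S))\<^sup>2"
      "c * (trace S)\<^sup>2 \<le> 3 * \<beta> * (trace S)\<^sup>2"
      by (auto simp: c_def intro!: mult_right_mono)
    moreover have "W_shell \<mu> lam \<mu>\<^sub>c S =
        \<mu> * (norm (dev (symm S)))\<^sup>2 + \<mu>\<^sub>c * (norm (skew S))\<^sup>2 + \<beta> * (trace S)\<^sup>2"
      unfolding W_shell_def norm_symm_dev \<beta>_def by (simp add: algebra_simps)
    ultimately show ?thesis
      unfolding norm_symm_skew[of S] norm_symm_dev[of S] by (simp add: algebra_simps)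
  qed
qed

lemma W_shell_nonneg:
  assumes "\<mu> > 0" "\<mu>\<^sub>c > 0" "2 * lam + \<mu> > 0"
  shows "W_shell \<mu> lam \<mu>\<^sub>c S \<ge> 0"
proof -
  obtain c where "c > 0" and c: "W_shell \<mu> lam \<mu>\<^sub>c S \<ge> c * (norm S)\<^sup>2"
    using W_shell_coercive[OF assms] by metis
  have "0 \<le> c * (norm S)\<^sup>2" using \<open>c > 0\<close> by simp
  then show ?thesis using c by linarith
qed

text \<open>The forms differ only in the trace coefficient, and the difference is a square divided
  by the positive number \<open>2 * (lam + 2 * \<mu>)\<close>.\<close>

lemma W_shell_le_W_mp:
  assumes "\<mu> > 0" "2 * lam + \<mu> > 0"
  shows "W_shell \<mu> lam \<mu>\<^sub>c S \<le> W_mp \<mu> lam \<mu>\<^sub>c S"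
proof -
  have pos: "lam + 2 * \<mu> > 0" using assms by linarith
  have "lam / 2 - lam * \<mu> / (lam + 2 * \<mu>) = lam\<^sup>2 / (2 * (lam + 2 * \<mu>))"
    using pos by (simp add: field_simps power2_eq_square)
  then have "lam * \<mu> / (lam + 2 * \<mu>) \<le> lam / 2"
    using pos by (smt (verit) divide_nonneg_pos zero_le_power2)
  then show ?thesis
    unfolding W_shell_def W_mp_def by (intro add_left_mono mult_right_mono zero_le_power2)
qed

lemma W_curv_coercive:
  assumes "\<mu> > 0" "L\<^sub>c > 0" "b1 > 0" "b2 > 0" "b3 > 0"
  obtains c where "c > 0" "\<And>S. W_curv \<mu> L\<^sub>c b1 b2 b3 S \<ge> c * (norm S)\<^sup>2"
proof
  define b where "b = min (min b1 b2) (3 * b3)"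
  define c where "c = \<mu> * L\<^sub>c\<^sup>2 * b"
  show "c > 0" using assms by (simp add: c_def b_def)
  show "W_curv \<mu> L\<^sub>c b1 b2 b3 S \<ge> c * (norm S)\<^sup>2" for S
  proof -
    have "b * (norm (dev (symm S)))\<^sup>2 \<le> b1 * (norm (dev (symm S)))\<^sup>2"
      "b * (norm (skew S))\<^sup>2 \<le> b2 * (norm (skew S))\<^sup>2"
      "b * (trace S)\<^sup>2 \<le> 3 * b3 * (trace S)\<^sup>2"
      by (auto simp: b_def intro!: mult_right_mono)
    then have "b * (norm S)\<^sup>2 \<le> b1 * (norm (dev (symm S)))\<^sup>2 + b2 * (norm (skew S))\<^sup>2 + b3 * (trace S)\<^sup>2"
      unfolding norm_symm_skew[of S] norm_symm_dev[of S] by (simp add: algebra_simps)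
    then show ?thesis
      using assms unfolding W_curv_def c_def by (simp add: mult.assoc)
  qed
qed

text \<open>Young's inequality with weight \<open>p\<close>: the form is nonnegative at
  \<open>p *\<^sub>R S + T\<close> and at \<open>p *\<^sub>R S - T\<close>, which bounds the mixed
  term with either sign.\<close>

lemma abs_W_shell2_le:
  assumes "\<mu> > 0" "\<mu>\<^sub>c > 0" "2 * lam + \<mu> > 0" "p > 0"
  shows "2 * \<bar>W_shell2 \<mu> lam \<mu>\<^sub>c S T\<bar> \<le> p * W_shell \<mu> lam \<mu>\<^sub>c S + W_shell \<mu> lam \<mu>\<^sub>c T / p"
proof -
  have "0 \<le> W_shell \<mu> lam \<mu>\<^sub>c (p *\<^sub>R S + s *\<^sub>R T)" for s
    by (rule W_shell_nonneg[OF assms(1-3)])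
  from this[of 1] this[of "- 1"]
  have "p * (2 * \<bar>W_shell2 \<mu> lam \<mu>\<^sub>c S T\<bar>) \<le> p\<^sup>2 * W_shell \<mu> lam \<mu>\<^sub>c S + W_shell \<mu> lam \<mu>\<^sub>c T"
    unfolding W_shell_add_scaleR by (auto simp: abs_if)
  then show ?thesis
    using \<open>p > 0\<close> by (simp add: field_simps power2_eq_square)
qed

section \<open>Lower bounds for the membrane, bending and curvature energies\<close>

lemma W_memb_add_W_memb_bend_ge:
  assumes "h > 0" "\<mu> > 0" "\<mu>\<^sub>c > 0" "2 * lam + \<mu> > 0"
    and H: "h * \<bar>mean_curvature y0 x\<bar> \<le> 1 / 2"
    and K: "h\<^sup>2 * \<bar>gauss_curvature y0 x\<bar> \<le> 1 / 4"
  shows "W_memb h \<mu> lam \<mu>\<^sub>c y0 x E + W_memb_bend h \<mu> lam \<mu>\<^sub>c y0 x E T \<ge> h / 4 * W_shell \<mu> lam \<mu>\<^sub>c E"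
proof -
  define F where "F = E ** B_tensor y0 x + C_tensor y0 x ** T"
  define G where "G = F ** B_tensor y0 x"
  define W where "W = W_shell \<mu> lam \<mu>\<^sub>c"
  define W2 where "W2 = W_shell2 \<mu> lam \<mu>\<^sub>c"
  define k where "k = gauss_curvature y0 x"
  define m where "m = mean_curvature y0 x"
  have W_nonneg: "0 \<le> W S" for S
    unfolding W_def by (rule W_shell_nonneg[OF assms(2-4)])
  have young: "2 * \<bar>W2 S S'\<bar> \<le> p * W S + W S' / p" if "p > 0" for p S S'
    unfolding W_def W2_def by (rule abs_W_shell2_le[OF assms(2-4) that])
  have k: "- 1/4 \<le> h\<^sup>2 * k" "h\<^sup>2 * k \<le> 1/4"
    using K abs_le_iff[of "h\<^sup>2 * k" "1/4"] by (auto simp: k_def abs_mult)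
  \<comment> \<open>The lower bound on the Gauss curvature is used here, 1 - 1/48 = 47/48; the next
    estimate uses the upper bound, 1/12 - 1/320 > 1/24.\<close>
  have cE: "(h + k * (h ^ 3 / 12)) * W E \<ge> 47/48 * h * W E"
  proof -
    have "h * (- 1/4) \<le> h * (h\<^sup>2 * k)"
      using k \<open>h > 0\<close> by (intro mult_left_mono) auto
    then have "47/48 * h \<le> h + k * (h ^ 3 / 12)"
      by (simp add: power3_eq_cube power2_eq_square mult_ac)
    then show ?thesis by (intro mult_right_mono W_nonneg)
  qed
  have cF: "(h ^ 3 / 12 - k * (h ^ 5 / 80)) * W F \<ge> h ^ 3 / 24 * W F"
  proof -
    have "h ^ 3 * (h\<^sup>2 * k) \<le> h ^ 3 * (1/4)"
      using k \<open>h > 0\<close> by (intro mult_left_mono) auto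
    then have "h ^ 5 * k \<le> h ^ 3 / 4"
      by (simp add: mult.assoc[symmetric] power_add[symmetric])
    moreover have "h ^ 3 > 0" using \<open>h > 0\<close> by simp
    ultimately have "h ^ 3 / 24 \<le> h ^ 3 / 12 - k * (h ^ 5 / 80)"
      unfolding times_divide_eq_right mult.commute[of k] by linarith
    then show ?thesis by (intro mult_right_mono W_nonneg)
  qed
  \<comment> \<open>The weight \<open>2 / h\<close> makes the cost in \<open>F\<close> exactly the
    \<open>h ^ 3 / 24\<close> available from \<open>cF\<close>.\<close>
  have EF: "h ^ 3 / 3 * m * W2 E F \<le> h / 6 * W E + h ^ 3 / 24 * W F"
  proof -
    have "h ^ 3 / 3 * m * W2 E F \<le> \<bar>h ^ 3 / 3 * m * W2 E F\<bar>" by simp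
    also have "\<dots> = (h * \<bar>m\<bar>) * (h\<^sup>2 / 6 * (2 * \<bar>W2 E F\<bar>))"
      using \<open>h > 0\<close> by (simp add: abs_mult power3_eq_cube power2_eq_square)
    also have "\<dots> \<le> (1 / 2) * (h\<^sup>2 / 6 * (2 / h * W E + W F / (2 / h)))"
      using H young[of "2 / h" E F] \<open>h > 0\<close> unfolding m_def[symmetric]
      by (intro mult_mono mult_left_mono) auto
    also have "\<dots> = h / 6 * W E + h ^ 3 / 24 * W F"
      using \<open>h > 0\<close> by (simp add: field_simps power3_eq_cube power2_eq_square)
    finally show ?thesis .
  qed
  \<comment> \<open>The weight \<open>20 / 3 / h\<^sup>2\<close> makes the cost in \<open>G\<close>
    exactly the \<open>h ^ 5 / 80\<close> supplied by the \<open>W_mp\<close> term.\<close>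
  have EG: "- (h ^ 3 / 6 * W2 E G) \<le> 5/9 * h * W E + h ^ 5 / 80 * W G"
  proof -
    have "- (h ^ 3 / 6 * W2 E G) \<le> h ^ 3 / 12 * (2 * \<bar>W2 E G\<bar>)"
      using \<open>h > 0\<close> by (simp add: abs_if field_simps)
    also have "\<dots> \<le> h ^ 3 / 12 * (20 / 3 / h\<^sup>2 * W E + W G / (20 / 3 / h\<^sup>2))"
      using young[of "20 / 3 / h\<^sup>2" E G] \<open>h > 0\<close> by (intro mult_left_mono) auto
    also have "\<dots> = 5/9 * h * W E + h ^ 5 / 80 * W G"
      using \<open>h > 0\<close> by (simp add: field_simps eval_nat_numeral)
    finally show ?thesis .
  qed
  have mp: "h ^ 5 / 80 * W G \<le> h ^ 5 / 80 * W_mp \<mu> lam \<mu>\<^sub>c G"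
    using W_shell_le_W_mp[OF assms(2,4)] \<open>h > 0\<close> by (intro mult_left_mono) (simp_all add: W_def)
  have "h * W E \<ge> 0" using \<open>h > 0\<close> W_nonneg by simp
  \<comment> \<open>The \<open>F\<close> and \<open>G\<close> terms cancel, and 47/48 - 1/6 - 5/9 =
    37/144 exceeds 1/4.\<close>
  then have "h / 4 * W E \<le> (h + k * (h ^ 3 / 12)) * W E
      + ((h ^ 3 / 12 - k * (h ^ 5 / 80)) * W F - h ^ 3 / 3 * m * W2 E F
        + h ^ 3 / 6 * W2 E G + h ^ 5 / 80 * W_mp \<mu> lam \<mu>\<^sub>c G)"
    using cE cF EF EG mp by linarith
  then show ?thesis
    by (simp add: W_memb_def W_memb_bend_def Let_def F_def G_def W_def W2_def k_def m_def)
qed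

lemma W_bend_curv_ge:
  assumes "h > 0" and nonneg: "\<And>S. W_curv \<mu> L\<^sub>c b1 b2 b3 S \<ge> 0"
    and K: "h\<^sup>2 * \<bar>gauss_curvature y0 x\<bar> \<le> 1 / 4"
  shows "W_bend_curv h \<mu> L\<^sub>c b1 b2 b3 y0 x T \<ge> h / 4 * W_curv \<mu> L\<^sub>c b1 b2 b3 T"
proof -
  define k where "k = gauss_curvature y0 x"
  have k: "h\<^sup>2 * k \<le> 1/4"
    using K abs_le_iff[of "h\<^sup>2 * k" "1/4"] by (auto simp: k_def abs_mult)
  have "h * (h\<^sup>2 * k) \<le> h * (1/4)" "h ^ 3 * (h\<^sup>2 * k) \<le> h ^ 3 * (1/4)"
    using k \<open>h > 0\<close> by (intro mult_left_mono; simp)+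
  then have "h ^ 3 * k \<le> h / 4" "h ^ 5 * k \<le> h ^ 3 / 4"
    by (simp_all add: mult.assoc[symmetric] power_add[symmetric] power_Suc[symmetric] del: power_Suc)
  moreover have "h ^ 3 > 0" using \<open>h > 0\<close> by simp
  ultimately have coeff: "h / 4 \<le> h - k * (h ^ 3 / 12)" "0 \<le> h ^ 3 / 12 - k * (h ^ 5 / 80)"
    unfolding times_divide_eq_right mult.commute[of k] using \<open>h > 0\<close> by linarith+
  define B where "B = B_tensor y0 x"
  have "h / 4 * W_curv \<mu> L\<^sub>c b1 b2 b3 T \<le> (h - k * (h ^ 3 / 12)) * W_curv \<mu> L\<^sub>c b1 b2 b3 T"
    using coeff(1) nonneg by (rule mult_right_mono)
  moreover have "0 \<le> (h ^ 3 / 12 - k * (h ^ 5 / 80)) * W_curv \<mu> L\<^sub>c b1 b2 b3 (T ** B)"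
    using coeff(2) nonneg by (rule mult_nonneg_nonneg)
  moreover have "0 \<le> h ^ 5 / 80 * W_curv \<mu> L\<^sub>c b1 b2 b3 (T ** (B ** B))"
    using \<open>h > 0\<close> nonneg by (intro mult_nonneg_nonneg) auto
  ultimately show ?thesis
    unfolding W_bend_curv_def k_def[symmetric] B_def[symmetric] by linarith
qed

section \<open>Real eigenvalues of the Weingarten map\<close>

text \<open>\<open>matrix_inv A ** S\<close> is self-adjoint for the inner product defined by the
  positive definite \<open>A\<close>, so its eigenvalues are real. In dimension two this becomes an
  explicit sum of squares.\<close>

lemma discriminant_inv_mult_nonneg:
  fixes A S :: "real ^ 2 ^ 2"
  assumes "transpose A = A" "transpose S = S" "A $ 1 $ 1 > 0" "det A > 0"
  shows "4 * det (matrix_inv A ** S) \<le> (trace (matrix_inv A ** S))\<^sup>2"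
proof -
  define L where "L = matrix_inv A ** S"
  have "invertible A" using assms by (simp add: invertible_det_nz)
  then have "A ** matrix_inv A = mat 1"
    unfolding invertible_def matrix_inv_def by (rule someI2_ex) simp
  then have "A ** L = S"
    unfolding L_def by (simp add: matrix_mul_assoc)
  moreover have sym: "A $ 2 $ 1 = A $ 1 $ 2" "S $ 2 $ 1 = S $ 1 $ 2"
    using arg_cong[OF assms(1), of "\<lambda>M. M $ 1 $ 2"] arg_cong[OF assms(2), of "\<lambda>M. M $ 1 $ 2"]
    by (simp_all add: transpose_def)
  \<comment> \<open>Symmetry of \<open>S = A ** L\<close> gives one linear relation between the
    entries of \<open>L\<close>.\<close>
  ultimately have "(A ** L) $ 1 $ 2 = (A ** L) $ 2 $ 1" by simp
  then have eq: "A $ 1 $ 1 * L $ 1 $ 2 + A $ 1 $ 2 * L $ 2 $ 2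
      = A $ 1 $ 2 * L $ 1 $ 1 + A $ 2 $ 2 * L $ 2 $ 1"
    by (simp add: matrix_matrix_mult_def sum_2 sym)
  \<comment> \<open>The discriminant is the squared difference of the diagonal entries plus four
    times the product of the off-diagonal ones. The factor \<open>(A $ 1 $ 1)\<^sup>2\<close> lets
    the relation eliminate \<open>L $ 1 $ 2\<close> without division; then the square is
    completed.\<close>
  have "(A $ 1 $ 1)\<^sup>2 * ((trace L)\<^sup>2 - 4 * det L)
      = (A $ 1 $ 1)\<^sup>2 * (L $ 1 $ 1 - L $ 2 $ 2)\<^sup>2 + 4 * A $ 1 $ 1 * (A $ 1 $ 1 * L $ 1 $ 2) * L $ 2 $ 1"
    by (simp add: trace_def sum_2 det_2 power2_eq_square algebra_simps)
  also have "A $ 1 $ 1 * L $ 1 $ 2 = A $ 1 $ 2 * (L $ 1 $ 1 - L $ 2 $ 2) + A $ 2 $ 2 * L $ 2 $ 1"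
    using eq by (simp add: algebra_simps)
  also have "(A $ 1 $ 1)\<^sup>2 * (L $ 1 $ 1 - L $ 2 $ 2)\<^sup>2
        + 4 * A $ 1 $ 1 * (A $ 1 $ 2 * (L $ 1 $ 1 - L $ 2 $ 2) + A $ 2 $ 2 * L $ 2 $ 1) * L $ 2 $ 1
      = (A $ 1 $ 1 * (L $ 1 $ 1 - L $ 2 $ 2) + 2 * A $ 1 $ 2 * L $ 2 $ 1)\<^sup>2
        + 4 * det A * (L $ 2 $ 1)\<^sup>2"
    by (simp add: det_2 sym power2_eq_square algebra_simps)
  also have "\<dots> \<ge> 0" using assms(4) by simp
  finally show ?thesis
    using assms(3) by (simp add: zero_le_mult_iff L_def)
qed

text \<open>A nonnegative discriminant makes both roots of the characteristic polynomial real. Each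
  root is an eigenvalue, and the trace and determinant are their sum and product.\<close>

lemma trace_det_bound_of_eigenvalues:
  fixes L :: "real ^ 2 ^ 2"
  assumes disc: "4 * det L \<le> (trace L)\<^sup>2"
    and eig: "\<And>\<kappa> v. v \<noteq> 0 \<Longrightarrow> L *v v = \<kappa> *\<^sub>R v \<Longrightarrow> \<bar>\<kappa>\<bar> \<le> c"
  shows "\<bar>trace L\<bar> \<le> 2 * c" "\<bar>det L\<bar> \<le> c\<^sup>2"
proof -
  define d where "d = sqrt ((trace L)\<^sup>2 - 4 * det L)"
  define \<kappa>1 where "\<kappa>1 = (trace L + d) / 2"
  define \<kappa>2 where "\<kappa>2 = (trace L - d) / 2"
  have d: "d\<^sup>2 = (trace L)\<^sup>2 - 4 * det L"
    using disc by (simp add: d_def)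
  have root: "\<bar>\<kappa>\<bar> \<le> c" if "\<kappa>\<^sup>2 - trace L * \<kappa> + det L = 0" for \<kappa>
  proof -
    have "det (L - \<kappa> *\<^sub>R mat 1) = 0"
      using that by (simp add: det_2 mat_def trace_def sum_2 power2_eq_square algebra_simps)
    then have "\<not> invertible (L - \<kappa> *\<^sub>R mat 1)"
      by (simp add: invertible_det_nz)
    then obtain v where "v \<noteq> 0" "(L - \<kappa> *\<^sub>R mat 1) *v v = 0"
      by (metis invertible_left_inverse matrix_left_invertible_ker)
    then have "L *v v = \<kappa> *\<^sub>R v"
      by (simp add: matrix_vector_mult_diff_rdistrib scaleR_matrix_vector_assoc[symmetric])
    with \<open>v \<noteq> 0\<close> show ?thesis by (rule eig)
  qed
  have "\<kappa>1\<^sup>2 - trace L * \<kappa>1 + det L = (d\<^sup>2 - (trace L)\<^sup>2 + 4 * det L) / 4"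
    "\<kappa>2\<^sup>2 - trace L * \<kappa>2 + det L = (d\<^sup>2 - (trace L)\<^sup>2 + 4 * det L) / 4"
    by (simp_all add: \<kappa>1_def \<kappa>2_def power2_eq_square field_simps)
  then have bounds: "\<bar>\<kappa>1\<bar> \<le> c" "\<bar>\<kappa>2\<bar> \<le> c"
    using d by (auto intro!: root)
  have "trace L = \<kappa>1 + \<kappa>2" by (simp add: \<kappa>1_def \<kappa>2_def field_simps)
  with bounds show "\<bar>trace L\<bar> \<le> 2 * c" by linarith
  have "det L = \<kappa>1 * \<kappa>2"
    using d by (simp add: \<kappa>1_def \<kappa>2_def power2_eq_square field_simps)
  then show "\<bar>det L\<bar> \<le> c\<^sup>2"
    using bounds by (auto simp: abs_mult power2_eq_square intro!: mult_mono)
qed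

section \<open>Symmetry of second derivatives\<close>

text \<open>The difference quotient is symmetric in \<open>v\<close> and \<open>w\<close> although the mean value theorem is applied only in
  direction \<open>v\<close>; exchanging the roles of the two directions yields symmetry.\<close>

lemma second_difference_tendsto:
  fixes f :: "'a::real_normed_vector \<Rightarrow> real"
  assumes "open S" "x \<in> S" and diff: "\<And>y. y \<in> S \<Longrightarrow> f differentiable (at y)"
    and G: "((\<lambda>y. frechet_derivative f (at y) v) has_derivative G) (at x)"
  shows "((\<lambda>t. (f (x + t *\<^sub>R v + t *\<^sub>R w) - f (x + t *\<^sub>R v) - f (x + t *\<^sub>R w) + f x) / t\<^sup>2)
    \<longlongrightarrow> G w) (at_right 0)"
proof (rule tendstoI)
  fix e :: real assume "e > 0"
  define N where "N = norm v + norm w"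
  \<comment> \<open>The summand 1 keeps the denominator positive when \<open>v\<close> and
    \<open>w\<close> both vanish and makes \<open>2 * N * e' < e\<close> strict.\<close>
  define e' where "e' = e / (2 * N + 1)"
  have "N \<ge> 0" by (simp add: N_def)
  then have "e' > 0" using \<open>e > 0\<close> by (simp add: e'_def)
  have "2 * N * e' < e"
    using \<open>e > 0\<close> \<open>N \<ge> 0\<close> by (simp add: e'_def field_simps)
  let ?D = "\<lambda>y. frechet_derivative f (at y) v"
  interpret G: bounded_linear G using G by (rule has_derivative_bounded_linear)
  obtain d where "d > 0"
    and d: "\<And>y. norm (y - x) < d \<Longrightarrow> \<bar>?D y - ?D x - G (y - x)\<bar> \<le> e' * norm (y - x)"
    using G \<open>e' > 0\<close> unfolding has_derivative_at_alt by (metis real_norm_def)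
  obtain r where "r > 0" and r: "ball x r \<subseteq> S"
    using assms(1,2) openE by blast
  define \<delta> where "\<delta> = min d r / (N + 1)"
  have "\<delta> > 0" using \<open>d > 0\<close> \<open>r > 0\<close> \<open>N \<ge> 0\<close> by (simp add: \<delta>_def)
  show "\<forall>\<^sub>F t in at_right 0. dist
      ((f (x + t *\<^sub>R v + t *\<^sub>R w) - f (x + t *\<^sub>R v) - f (x + t *\<^sub>R w) + f x) / t\<^sup>2) (G w) < e"
    unfolding eventually_at_right_field
  proof (intro exI[of _ \<delta>] conjI allI impI)
    show "0 < \<delta>" by fact
    fix t :: real assume "0 < t" "t < \<delta>"
    have "t * N < min d r"
    proof -
      have "t * N \<le> t * (N + 1)" using \<open>0 < t\<close> by simp
      also have "\<dots> < min d r"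
        using \<open>t < \<delta>\<close> \<open>N \<ge> 0\<close> by (simp add: \<delta>_def pos_less_divide_eq)
      finally show ?thesis .
    qed
    have near: "norm (s *\<^sub>R v + t' *\<^sub>R w) \<le> t * N" if "0 \<le> s" "s \<le> t" "0 \<le> t'" "t' \<le> t" for s t'
    proof -
      have "norm (s *\<^sub>R v + t' *\<^sub>R w) \<le> s * norm v + t' * norm w"
        using that norm_triangle_ineq[of "s *\<^sub>R v" "t' *\<^sub>R w"] by simp
      also have "\<dots> \<le> t * norm v + t * norm w"
        using that by (intro add_mono mult_right_mono) auto
      finally show ?thesis by (simp add: N_def distrib_left)
    qed
    have in_S: "x + s *\<^sub>R v + t' *\<^sub>R w \<in> S" if "0 \<le> s" "s \<le> t" "0 \<le> t'" "t' \<le> t" for s t'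
    proof -
      have "dist x (x + s *\<^sub>R v + t' *\<^sub>R w) = norm (s *\<^sub>R v + t' *\<^sub>R w)"
        by (metis add.assoc add_diff_cancel_left' dist_commute dist_norm)
      then show ?thesis
        using near[OF that] \<open>t * N < min d r\<close> r by auto
    qed
    have deriv: "((\<lambda>s. f (x + s *\<^sub>R v + t' *\<^sub>R w)) has_real_derivative ?D (x + s *\<^sub>R v + t' *\<^sub>R w)) (at s)"
      if "0 \<le> s" "s \<le> t" "0 \<le> t'" "t' \<le> t" for s t'
    proof -
      let ?y = "x + s *\<^sub>R v + t' *\<^sub>R w"
      have f': "(f has_derivative frechet_derivative f (at ?y)) (at ?y)"
        using diff[OF in_S[OF that]] by (simp add: frechet_derivative_works)
      have "((\<lambda>s. x + s *\<^sub>R v + t' *\<^sub>R w) has_derivative (\<lambda>s. s *\<^sub>R v)) (at s)"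
        by (auto intro!: derivative_eq_intros)
      from has_derivative_compose[OF this f']
      have "((\<lambda>s. f (x + s *\<^sub>R v + t' *\<^sub>R w)) has_derivative
          (\<lambda>s. frechet_derivative f (at ?y) (s *\<^sub>R v))) (at s)" .
      then show ?thesis
        unfolding has_field_derivative_def
        using linear_frechet_derivative[OF diff[OF in_S[OF that]]]
        by (simp add: linear_scale mult.commute[of _ "?D ?y"])
    qed
    \<comment> \<open>The increment in direction \<open>w\<close>, as a function of the position
      along \<open>v\<close>. The term \<open>0 *\<^sub>R w\<close> is kept so that
      \<open>deriv\<close> covers both summands.\<close>
    define \<phi> where "\<phi> s = f (x + s *\<^sub>R v + t *\<^sub>R w) - f (x + s *\<^sub>R v + 0 *\<^sub>R w)" for s
    have "\<exists>\<xi>. 0 < \<xi> \<and> \<xi> < t \<and>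
        \<phi> t - \<phi> 0 = (t - 0) * (?D (x + \<xi> *\<^sub>R v + t *\<^sub>R w) - ?D (x + \<xi> *\<^sub>R v + 0 *\<^sub>R w))"
      using \<open>0 < t\<close> unfolding \<phi>_def by (intro MVT2 DERIV_diff deriv) auto
    then obtain \<xi> where \<xi>: "0 < \<xi>" "\<xi> < t"
      and mvt: "\<phi> t - \<phi> 0 = t * (?D (x + \<xi> *\<^sub>R v + t *\<^sub>R w) - ?D (x + \<xi> *\<^sub>R v + 0 *\<^sub>R w))"
      by auto
    \<comment> \<open>Differentiability of \<open>?D\<close> at \<open>x\<close> is applied at both
      ends of the increment. Subtracting the two estimates cancels \<open>?D x\<close> and, by
      linearity of \<open>G\<close>, the contribution of \<open>v\<close>, leaving
      \<open>t * G w\<close>.\<close>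
    have est: "\<bar>?D (x + \<xi> *\<^sub>R v + t' *\<^sub>R w) - ?D x - G (\<xi> *\<^sub>R v + t' *\<^sub>R w)\<bar> \<le> e' * (t * N)"
      if "0 \<le> t'" "t' \<le> t" for t'
    proof -
      have n: "norm (\<xi> *\<^sub>R v + t' *\<^sub>R w) \<le> t * N" using near \<xi> that by simp
      then have "\<bar>?D (x + \<xi> *\<^sub>R v + t' *\<^sub>R w) - ?D x - G (\<xi> *\<^sub>R v + t' *\<^sub>R w)\<bar>
          \<le> e' * norm (\<xi> *\<^sub>R v + t' *\<^sub>R w)"
        using d[of "x + \<xi> *\<^sub>R v + t' *\<^sub>R w"] \<open>t * N < min d r\<close> by (simp add: add.assoc)
      also have "\<dots> \<le> e' * (t * N)" using n \<open>e' > 0\<close> by simp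
      finally show ?thesis .
    qed
    have "\<bar>?D (x + \<xi> *\<^sub>R v + t *\<^sub>R w) - ?D (x + \<xi> *\<^sub>R v + 0 *\<^sub>R w) - t * G w\<bar> \<le> 2 * (e' * (t * N))"
      using est[of t] est[of 0] \<open>0 < t\<close> by (simp add: G.add G.scaleR)
    also have "\<dots> = t * (2 * N * e')" by simp
    finally have b: "\<bar>?D (x + \<xi> *\<^sub>R v + t *\<^sub>R w) - ?D (x + \<xi> *\<^sub>R v + 0 *\<^sub>R w) - t * G w\<bar> \<le> t * (2 * N * e')" .
    have num: "f (x + t *\<^sub>R v + t *\<^sub>R w) - f (x + t *\<^sub>R v) - f (x + t *\<^sub>R w) + f x = \<phi> t - \<phi> 0"
      by (simp add: \<phi>_def)
    have "(f (x + t *\<^sub>R v + t *\<^sub>R w) - f (x + t *\<^sub>R v) - f (x + t *\<^sub>R w) + f x) / t\<^sup>2 - G w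
        = (?D (x + \<xi> *\<^sub>R v + t *\<^sub>R w) - ?D (x + \<xi> *\<^sub>R v + 0 *\<^sub>R w) - t * G w) / t"
      unfolding num mvt using \<open>0 < t\<close> by (simp add: field_simps power2_eq_square)
    also have "\<bar>\<dots>\<bar> \<le> 2 * N * e'"
      using b \<open>0 < t\<close> by (simp add: field_simps)
    finally show "dist ((f (x + t *\<^sub>R v + t *\<^sub>R w) - f (x + t *\<^sub>R v) - f (x + t *\<^sub>R w) + f x) / t\<^sup>2) (G w) < e"
      using \<open>2 * N * e' < e\<close> by (simp add: dist_real_def)
  qed
qed

lemma second_derivative_symmetric_real:
  fixes f :: "'a::real_normed_vector \<Rightarrow> real"
  assumes "open S" "x \<in> S" "\<And>y. y \<in> S \<Longrightarrow> f differentiable (at y)"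
    and "((\<lambda>y. frechet_derivative f (at y) v) has_derivative G) (at x)"
    and "((\<lambda>y. frechet_derivative f (at y) w) has_derivative G') (at x)"
  shows "G w = G' v"
proof (rule tendsto_unique[OF trivial_limit_at_right_real])
  show "((\<lambda>t. (f (x + t *\<^sub>R v + t *\<^sub>R w) - f (x + t *\<^sub>R v) - f (x + t *\<^sub>R w) + f x) / t\<^sup>2)
    \<longlongrightarrow> G w) (at_right 0)"
    using second_difference_tendsto[OF assms(1-4)] .
  show "((\<lambda>t. (f (x + t *\<^sub>R v + t *\<^sub>R w) - f (x + t *\<^sub>R v) - f (x + t *\<^sub>R w) + f x) / t\<^sup>2)
    \<longlongrightarrow> G' v) (at_right 0)"
    using second_difference_tendsto[OF assms(1-3,5), of v] by (simp add: algebra_simps)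
qed

text \<open>Pairing with an arbitrary vector \<open>u\<close> reduces the claim to real-valued
  functions.\<close>

lemma second_derivative_symmetric:
  fixes f :: "'a::real_normed_vector \<Rightarrow> 'b::real_inner"
  assumes "open S" "x \<in> S" and diff: "\<And>y. y \<in> S \<Longrightarrow> f differentiable (at y)"
    and G: "((\<lambda>y. frechet_derivative f (at y) v) has_derivative G) (at x)"
    and G': "((\<lambda>y. frechet_derivative f (at y) w) has_derivative G') (at x)"
  shows "G w = G' v"
proof -
  have "G w \<bullet> u = G' v \<bullet> u" for u
  proof (rule second_derivative_symmetric_real[OF assms(1,2)])
    have D: "((\<lambda>y. f y \<bullet> u) has_derivative (\<lambda>z. frechet_derivative f (at y) z \<bullet> u)) (at y)"
      if "y \<in> S" for y
      using diff[OF that] by (auto simp: frechet_derivative_works intro!: derivative_eq_intros)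
    then show "(\<lambda>y. f y \<bullet> u) differentiable (at y)" if "y \<in> S" for y
      using that by (auto simp: differentiable_def)
    have eq: "frechet_derivative f (at y) z \<bullet> u = frechet_derivative (\<lambda>y. f y \<bullet> u) (at y) z"
      if "y \<in> S" for y z
      using frechet_derivative_at[OF D[OF that]] by metis
    show "((\<lambda>y. frechet_derivative (\<lambda>y. f y \<bullet> u) (at y) v) has_derivative (\<lambda>z. G z \<bullet> u)) (at x)"
      by (rule has_derivative_transform_within_open[OF _ assms(1,2) eq])
        (auto intro!: derivative_eq_intros G)
    show "((\<lambda>y. frechet_derivative (\<lambda>y. f y \<bullet> u) (at y) w) has_derivative (\<lambda>z. G' z \<bullet> u)) (at x)"
      by (rule has_derivative_transform_within_open[OF _ assms(1,2) eq])
        (auto intro!: derivative_eq_intros G')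
  qed
  then have "(G w - G' v) \<bullet> (G w - G' v) = 0"
    unfolding inner_diff_left by simp
  then show ?thesis by simp
qed

section \<open>Curvature bounds of the reference midsurface\<close>

lemma bounded_bilinear_cross3: "bounded_bilinear cross3"
  unfolding bilinear_conv_bounded_bilinear[symmetric] bilinear_def
  by (auto intro!: linearI simp: cross_add_left cross_add_right cross_mult_left cross_mult_right)

lemma reference_shell_open:
  assumes "reference_shell \<omega> h y0"
  shows "open \<omega>"
  using assms by (simp add: reference_shell_def bounded_lipschitz_domain_def)

text \<open>Where the cross product vanishes, the junk value of the unit normal is 0 and the shell map
  is constant in the thickness direction.\<close>

lemma reference_shell_cross3_nonzero:
  assumes shell: "reference_shell \<omega> h y0" and "h > 0" "x \<in> \<omega>"
  shows "cross3 (partial 1 y0 x) (partial 2 y0 x) \<noteq> 0"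
proof
  assume "cross3 (partial 1 y0 x) (partial 2 y0 x) = 0"
  then have "unit_normal y0 x = 0" by (simp add: unit_normal_def)
  define X :: "real \<Rightarrow> real ^ 3" where "X t = vector [x $ 1, x $ 2, t]" for t
  have x: "vector [x $ 1, x $ 2] = x"
    by (simp add: vec_eq_iff forall_2)
  have "shell_map y0 (X t) = y0 x" for t
    using \<open>unit_normal y0 x = 0\<close> by (simp add: shell_map_def X_def x)
  moreover have "X 0 \<in> shell_domain \<omega> h" "X (h / 4) \<in> shell_domain \<omega> h"
    using assms by (simp_all add: shell_domain_def X_def x)
  moreover have "inj_on (shell_map y0) (shell_domain \<omega> h)"
    using shell by (simp add: reference_shell_def C1_diffeo_onto_image_def)
  ultimately have "X 0 = X (h / 4)" by (metis inj_onD)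
  then have "X 0 $ 3 = X (h / 4) $ 3" by simp
  then show False using \<open>h > 0\<close> by (simp add: X_def)
qed

section \<open>The fundamental forms and the Weingarten discriminant\<close>

lemma transpose_jacobian_mult_jacobian:
  fixes f g :: "real ^ 2 \<Rightarrow> real ^ 3"
  shows "(transpose (jacobian f (at x)) ** jacobian g (at x)) $ i $ j = partial i f x \<bullet> partial j g x"
  by (simp add: transpose_def matrix_matrix_mult_def jacobian_def matrix_def partial_def inner_vec_def)

lemma reference_shell_partial_differentiable:
  assumes "reference_shell \<omega> h y0" "x \<in> \<omega>"
  shows "partial i y0 differentiable (at x)"
  using assms unfolding partial_def[abs_def] reference_shell_def C2_on_def C1_on_def by auto

text \<open>The cross product of the partial derivatives is differentiable because \<open>y0\<close>
  is twice differentiable, and normalization preserves this since it does not vanish.\<close>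

lemma unit_normal_differentiable:
  assumes shell: "reference_shell \<omega> h y0" and "h > 0" "x \<in> \<omega>"
  shows "unit_normal y0 differentiable (at x)"
proof -
  let ?c = "\<lambda>x. cross3 (partial 1 y0 x) (partial 2 y0 x)"
  have "(partial i y0 has_derivative frechet_derivative (partial i y0) (at x)) (at x)" for i
    using reference_shell_partial_differentiable[OF shell \<open>x \<in> \<omega>\<close>]
    by (simp add: frechet_derivative_works)
  from bounded_bilinear.FDERIV[OF bounded_bilinear_cross3 this[of 1] this[of 2]]
  have c: "?c differentiable (at x)"
    by (rule differentiableI)
  moreover have "(\<lambda>x. norm (?c x)) differentiable (at x)"
    using differentiable_chain_at[OF c, of norm]
      differentiable_norm_at[OF reference_shell_cross3_nonzero[OF assms]]
    by (simp add: o_def)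
  ultimately have "(\<lambda>x. inverse (norm (?c x)) *\<^sub>R ?c x) differentiable (at x)"
    using reference_shell_cross3_nonzero[OF assms]
    by (intro differentiable_scaleR differentiable_inverse) auto
  then show ?thesis
    by (simp add: unit_normal_def[abs_def] Let_def inverse_eq_divide)
qed

text \<open>This holds at every point, including those where \<open>unit_normal\<close> takes its
  default value 0; the inner product is thus identically zero and can be differentiated.\<close>

lemma unit_normal_orthogonal: "unit_normal y0 x \<bullet> partial i y0 x = 0"
proof -
  consider "i = 1" | "i = 2" using exhaust_2 by blast
  then show ?thesis
    by cases (simp_all add: unit_normal_def Let_def dot_cross_self)
qed

text \<open>Differentiating the orthogonality of normal and tangent vectors turns each entry into
  the normal component of a second derivative of \<open>y0\<close>, and second derivatives
  commute.\<close>

lemma second_form_symmetric: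
  assumes shell: "reference_shell \<omega> h y0" and "h > 0" "x \<in> \<omega>"
  shows "transpose (second_form y0 x) = second_form y0 x"
proof -
  let ?D = "\<lambda>i. frechet_derivative (partial i y0) (at x)"
  have D: "(partial i y0 has_derivative ?D i) (at x)" for i
    using reference_shell_partial_differentiable[OF shell \<open>x \<in> \<omega>\<close>]
    by (simp add: frechet_derivative_works)
  have N: "(unit_normal y0 has_derivative frechet_derivative (unit_normal y0) (at x)) (at x)"
    using unit_normal_differentiable[OF assms] by (simp add: frechet_derivative_works)
  have eq: "partial i y0 x \<bullet> partial j (unit_normal y0) x = - (unit_normal y0 x \<bullet> ?D i (axis j 1))" for i j
  proof -
    have "((\<lambda>x. unit_normal y0 x \<bullet> partial i y0 x) has_derivative
        (\<lambda>z. unit_normal y0 x \<bullet> ?D i z + frechet_derivative (unit_normal y0) (at x) z \<bullet> partial i y0 x)) (at x)"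
      by (rule has_derivative_inner[OF N D])
    then have "(\<lambda>z. unit_normal y0 x \<bullet> ?D i z + frechet_derivative (unit_normal y0) (at x) z \<bullet> partial i y0 x)
        = (\<lambda>z. 0)"
      unfolding unit_normal_orthogonal by (rule has_derivative_unique[OF _ has_derivative_const])
    from fun_cong[OF this, of "axis j 1"] show ?thesis
      by (simp add: partial_def[of j] inner_commute)
  qed
  have mixed: "?D i (axis j 1) = ?D j (axis i 1)" for i j
  proof (rule second_derivative_symmetric[where f = y0 and S = \<omega> and x = x and v = "axis i 1" and w = "axis j 1"])
    show "open \<omega>" using shell by (rule reference_shell_open)
    show "y0 differentiable (at y)" if "y \<in> \<omega>" for y
      using shell that by (simp add: reference_shell_def C2_on_def C1_on_def)
    show "x \<in> \<omega>" by fact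
    show "((\<lambda>y. frechet_derivative y0 (at y) (axis i 1)) has_derivative ?D i) (at x)"
      "((\<lambda>y. frechet_derivative y0 (at y) (axis j 1)) has_derivative ?D j) (at x)"
      using D unfolding partial_def[abs_def] by blast+
  qed
  have "second_form y0 x $ i $ j = second_form y0 x $ j $ i" for i j
    using mixed[of i j] by (simp add: second_form_def transpose_jacobian_mult_jacobian eq)
  then show ?thesis
    by (simp add: vec_eq_iff transpose_def)
qed

lemma weingarten_discriminant_nonneg:
  assumes shell: "reference_shell \<omega> h y0" and "h > 0" "x \<in> \<omega>"
  shows "4 * det (weingarten y0 x) \<le> (trace (weingarten y0 x))\<^sup>2"
  unfolding weingarten_def
proof (rule discriminant_inv_mult_nonneg)
  have entry: "first_form y0 x $ i $ j = partial i y0 x \<bullet> partial j y0 x" for i j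
    by (simp add: first_form_def transpose_jacobian_mult_jacobian)
  show "transpose (first_form y0 x) = first_form y0 x"
    by (simp add: first_form_def matrix_transpose_mul)
  show "transpose (second_form y0 x) = second_form y0 x"
    using assms by (rule second_form_symmetric)
  note nz = reference_shell_cross3_nonzero[OF assms]
  then show "first_form y0 x $ 1 $ 1 > 0"
    by (auto simp: entry)
  \<comment> \<open>Lagrange's identity for the cross product.\<close>
  have "det (first_form y0 x) = (norm (cross3 (partial 1 y0 x) (partial 2 y0 x)))\<^sup>2"
    unfolding norm_cross unfolding power2_norm_eq_inner
    by (simp add: det_2 entry inner_commute power2_eq_square)
  then show "det (first_form y0 x) > 0" using nz by simp
qed

text \<open>The eigenvalue bound is applied with \<open>c = 1 / (2 * h)\<close>; the mean curvature
  is half the trace.\<close>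

lemma curvature_bounds:
  assumes shell: "reference_shell \<omega> h y0" and "h > 0" "x \<in> \<omega>"
    and thin: "\<And>\<kappa>. principal_curvature y0 x \<kappa> \<Longrightarrow> h * \<bar>\<kappa>\<bar> < 1 / 2"
  shows "h * \<bar>mean_curvature y0 x\<bar> \<le> 1 / 2" "h\<^sup>2 * \<bar>gauss_curvature y0 x\<bar> \<le> 1 / 4"
proof -
  have "\<bar>\<kappa>\<bar> \<le> 1 / (2 * h)" if "v \<noteq> 0" "weingarten y0 x *v v = \<kappa> *\<^sub>R v" for \<kappa> v
  proof -
    have "h * \<bar>\<kappa>\<bar> < 1 / 2" using thin that by (auto simp: principal_curvature_def)
    then show ?thesis using \<open>h > 0\<close> by (simp add: field_simps)
  qed
  note * = trace_det_bound_of_eigenvalues[OF weingarten_discriminant_nonneg[OF assms(1-3)] this]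
  show "h * \<bar>mean_curvature y0 x\<bar> \<le> 1 / 2" "h\<^sup>2 * \<bar>gauss_curvature y0 x\<bar> \<le> 1 / 4"
    using * \<open>h > 0\<close> by (simp_all add: mean_curvature_def gauss_curvature_def field_simps power2_eq_square)
qed

text \<open>The constant is chosen before \<open>\<omega>\<close> and \<open>y0\<close>, so it
  depends only on \<open>h\<close>, \<open>L\<^sub>c\<close> and the constitutive
  coefficients.\<close>

theorem proposition3p1:
  fixes h \<mu> lam \<mu>\<^sub>c L\<^sub>c b1 b2 b3 :: real
  assumes "h > 0" and "L\<^sub>c > 0"
    and "\<mu> > 0" and "\<mu>\<^sub>c > 0" and "2 * lam + \<mu> > 0"
    and "b1 > 0" and "b2 > 0" and "b3 > 0"
  shows "\<exists>a1>0. \<forall>\<omega> y0.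
    reference_shell \<omega> h y0 \<and>
    (\<forall>x\<in>\<omega>. \<forall>\<kappa>. principal_curvature y0 x \<kappa> \<longrightarrow> h * \<bar>\<kappa>\<bar> < 1/2) \<longrightarrow>
    (\<forall>m Q. (\<forall>x\<in>\<omega>. rotation_matrix (Q x)) \<longrightarrow>
      (\<forall>x\<in>\<omega>. m differentiable (at x) \<and> Q differentiable (at x) \<longrightarrow>
        W_energy h \<mu> lam \<mu>\<^sub>c L\<^sub>c b1 b2 b3 y0 x (strain y0 m Q x) (bending_curvature y0 Q x)
          \<ge> a1 * ((norm (strain y0 m Q x))\<^sup>2 + (norm (bending_curvature y0 Q x))\<^sup>2)))"
proof -
  obtain cs where "cs > 0" and cs: "\<And>S. W_shell \<mu> lam \<mu>\<^sub>c S \<ge> cs * (norm S)\<^sup>2"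
    using W_shell_coercive[OF assms(3-5)] by metis
  obtain cc where "cc > 0" and cc: "\<And>S. W_curv \<mu> L\<^sub>c b1 b2 b3 S \<ge> cc * (norm S)\<^sup>2"
    using W_curv_coercive[OF assms(3,2,6-8)] by metis
  have curv_nonneg: "W_curv \<mu> L\<^sub>c b1 b2 b3 S \<ge> 0" for S
    using cc[of S] \<open>cc > 0\<close> by (smt (verit) mult_nonneg_nonneg zero_le_power2)
  define a1 where "a1 = h / 4 * min cs cc"
  have "a1 > 0" using \<open>h > 0\<close> \<open>cs > 0\<close> \<open>cc > 0\<close> by (simp add: a1_def)
  \<comment> \<open>The bound is established pointwise for arbitrary tensors \<open>E\<close> and
    \<open>T\<close> and then specialized to the two strain measures.\<close>
  have "W_energy h \<mu> lam \<mu>\<^sub>c L\<^sub>c b1 b2 b3 y0 x E T \<ge> a1 * ((norm E)\<^sup>2 + (norm T)\<^sup>2)"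
    if "reference_shell \<omega> h y0" "x \<in> \<omega>"
      "\<And>\<kappa>. principal_curvature y0 x \<kappa> \<Longrightarrow> h * \<bar>\<kappa>\<bar> < 1/2" for \<omega> y0 x E T
  proof -
    note bounds = curvature_bounds[OF that(1) \<open>h > 0\<close> that(2,3)]
    have "a1 * (norm E)\<^sup>2 \<le> h / 4 * (cs * (norm E)\<^sup>2)"
      unfolding a1_def mult.assoc using \<open>h > 0\<close> by (intro mult_left_mono mult_right_mono) auto
    also have "\<dots> \<le> h / 4 * W_shell \<mu> lam \<mu>\<^sub>c E"
      using cs \<open>h > 0\<close> by (intro mult_left_mono) auto
    also have "\<dots> \<le> W_memb h \<mu> lam \<mu>\<^sub>c y0 x E + W_memb_bend h \<mu> lam \<mu>\<^sub>c y0 x E T"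
      using bounds by (intro W_memb_add_W_memb_bend_ge assms)
    finally have E: "a1 * (norm E)\<^sup>2 \<le> \<dots>" .
    have "a1 * (norm T)\<^sup>2 \<le> h / 4 * (cc * (norm T)\<^sup>2)"
      unfolding a1_def mult.assoc using \<open>h > 0\<close> by (intro mult_left_mono mult_right_mono) auto
    also have "\<dots> \<le> h / 4 * W_curv \<mu> L\<^sub>c b1 b2 b3 T"
      using cc \<open>h > 0\<close> by (intro mult_left_mono) auto
    also have "\<dots> \<le> W_bend_curv h \<mu> L\<^sub>c b1 b2 b3 y0 x T"
      using bounds by (intro W_bend_curv_ge assms curv_nonneg)
    finally show ?thesis
      using E unfolding W_energy_def distrib_left by linarith
  qed
  then show ?thesis using \<open>a1 > 0\<close> by blast
qed

end
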